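(* Let $n\ge 1$ and let $z_1,z_2,\ldots,z_n\in\mathbb{C}$ be distinct points with $|z_i|=1$ for $1\le i\le n$. Set $\mathscr{D}_{\{z_i\}}=\{f\in\mathscr{D}(H) : \tilde f(z_i)=0,\ 1\le i\le n\}$ and let $L_n$ be the restriction of $H=z\frac{d}{dz}$ to $\mathscr{D}_{\{z_i\}}$. Then $L_n$ is Hermitian with dense domain in $\mathscr{H}_2$, and has deficiency indices $(n,n)$.
   Context: $\mathbb{D}=\{z\in\mathbb{C}:|z|<1\}$, $\mathbb{N}_0=\{0,1,2,\ldots\}$. $\mathscr{H}_2$ is the Hardy space of analytic functions $f(z)=\sum_{k\in\mathbb{N}_0}x_kz^k$ on $\mathbb{D}$ with $\|f\|^2=\sum|x_k|^2<\infty$. $H=z\frac{d}{dz}$ is the selfadjoint operator in $\mathscr{H}_2$ with domain $\mathscr{D}(H)=\{f\in\mathscr{H}_2: z\frac{d}{dz}f\in\mathscr{H}_2\}$, i.e. $\sum k^2|x_k|^2<\infty$. For $f\in\mathscr{D}(H)$ the Taylor coefficients are absolutely summable, so $f$ has a continuous extension $\tilde f(z)=\sum_k x_kz^k$ to $\overline{\mathbb{D}}$. "Hermitian" means $\langle f,Lg\rangle=\langle Lf,g\rangle$ for all $f,g$ in the domain. The deficiency indices of a densely defined Hermitian operator $L$ are $(\dim\ker(L^*-iI),\dim\ker(L^*+iI))$. *)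

theory Defs
  imports
    "HOL-Complex_Analysis.Complex_Analysis"
    "HOL-Library.Function_Algebras"
    "HOL-Library.Extended_Nat"
begin

definition cscale :: "complex \<Rightarrow> (complex \<Rightarrow> complex) \<Rightarrow> complex \<Rightarrow> complex" where
  "cscale c f = (\<lambda>z. c * f z)"

interpretation cfun: vector_space cscale
  by unfold_locales (auto simp: cscale_def fun_eq_iff algebra_simps)

text \<open>Dimension over the complex numbers. The library's \<open>dim\<close> is 0 on infinite-dimensional
  subspaces; here these get dimension \<open>\<infinity>\<close>.\<close>

definition cdim :: "(complex \<Rightarrow> complex) set \<Rightarrow> enat" where
  "cdim V = (if \<exists>B. finite B \<and> V \<subseteq> cfun.span B then enat (cfun.dim V) else \<infinity>)"

definition taylor_coeff :: "(complex \<Rightarrow> complex) \<Rightarrow> nat \<Rightarrow> complex" where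
  "taylor_coeff f k = (deriv ^^ k) f 0 / fact k"

text \<open>A function on the unit disc is represented by its extension by 0 to the complex plane, so
  that elements of the Hardy space are equal as soon as they agree on the disc.\<close>

definition hardy2 :: "(complex \<Rightarrow> complex) set" where
  "hardy2 = {f. f holomorphic_on ball 0 1 \<and> (\<forall>z. z \<notin> ball 0 1 \<longrightarrow> f z = 0) \<and>
                summable (\<lambda>k. (cmod (taylor_coeff f k))\<^sup>2)}"

definition hardy_inner :: "(complex \<Rightarrow> complex) \<Rightarrow> (complex \<Rightarrow> complex) \<Rightarrow> complex" where
  "hardy_inner f g = (\<Sum>k. cnj (taylor_coeff f k) * taylor_coeff g k)"

definition hardy_norm :: "(complex \<Rightarrow> complex) \<Rightarrow> real" where
  "hardy_norm f = sqrt (\<Sum>k. (cmod (taylor_coeff f k))\<^sup>2)"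

text \<open>An unbounded operator in the Hardy space is a pair of its domain and its action; the values
  of the action outside the domain are irrelevant.\<close>

type_synonym hardy_op = "(complex \<Rightarrow> complex) set \<times> ((complex \<Rightarrow> complex) \<Rightarrow> (complex \<Rightarrow> complex))"

abbreviation op_dom :: "hardy_op \<Rightarrow> (complex \<Rightarrow> complex) set" where
  "op_dom L \<equiv> fst L"

abbreviation op_app :: "hardy_op \<Rightarrow> (complex \<Rightarrow> complex) \<Rightarrow> (complex \<Rightarrow> complex)" where
  "op_app L \<equiv> snd L"

definition op_restrict :: "hardy_op \<Rightarrow> (complex \<Rightarrow> complex) set \<Rightarrow> hardy_op" where
  "op_restrict L D = (op_dom L \<inter> D, op_app L)"

definition densely_defined :: "hardy_op \<Rightarrow> bool" where
  "densely_defined L \<longleftrightarrow>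
     op_dom L \<subseteq> hardy2 \<and> (\<forall>f\<in>hardy2. \<forall>e>0. \<exists>g\<in>op_dom L. hardy_norm (f - g) < e)"

definition hermitian :: "hardy_op \<Rightarrow> bool" where
  "hermitian L \<longleftrightarrow>
     (\<forall>f\<in>op_dom L. \<forall>g\<in>op_dom L. hardy_inner f (op_app L g) = hardy_inner (op_app L f) g)"

text \<open>The \<open>THE\<close> is well defined for densely defined \<open>L\<close>.\<close>

definition adjoint_op :: "hardy_op \<Rightarrow> hardy_op" where
  "adjoint_op L =
     ({g\<in>hardy2. \<exists>h\<in>hardy2. \<forall>f\<in>op_dom L. hardy_inner g (op_app L f) = hardy_inner h f},
      \<lambda>g. THE h. h \<in> hardy2 \<and> (\<forall>f\<in>op_dom L. hardy_inner g (op_app L f) = hardy_inner h f))"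

text \<open>The kernel of \<open>L - c I\<close>.\<close>

definition eigen_ker :: "hardy_op \<Rightarrow> complex \<Rightarrow> (complex \<Rightarrow> complex) set" where
  "eigen_ker L c = {f\<in>op_dom L. op_app L f - cscale c f = 0}"

definition deficiency_indices :: "hardy_op \<Rightarrow> enat \<times> enat" where
  "deficiency_indices L =
     (cdim (eigen_ker (adjoint_op L) \<i>), cdim (eigen_ker (adjoint_op L) (- \<i>)))"

definition zddz :: "(complex \<Rightarrow> complex) \<Rightarrow> complex \<Rightarrow> complex" where
  "zddz f = (\<lambda>z. if z \<in> ball 0 1 then z * deriv f z else 0)"

definition H_op :: hardy_op where
  "H_op = ({f\<in>hardy2. zddz f \<in> hardy2}, zddz)"

text \<open>For \<open>f\<close> in the domain of \<open>H_op\<close> the series converges absolutely on the closed disc; this is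
  the continuous extension of \<open>f\<close> (whose own values on the unit circle are 0 by convention).\<close>

definition disc_ext :: "(complex \<Rightarrow> complex) \<Rightarrow> complex \<Rightarrow> complex" where
  "disc_ext f z = (\<Sum>k. taylor_coeff f k * z ^ k)"

definition D_pts :: "nat \<Rightarrow> (nat \<Rightarrow> complex) \<Rightarrow> (complex \<Rightarrow> complex) set" where
  "D_pts n z = {f\<in>op_dom H_op. \<forall>i\<in>{1..n}. disc_ext f (z i) = 0}"

definition L_op :: "nat \<Rightarrow> (nat \<Rightarrow> complex) \<Rightarrow> hardy_op" where
  "L_op n z = op_restrict H_op (D_pts n z)"

end

theory Submission
  imports Defs
begin

text \<open>
  On Taylor coefficients \<open>x\<^sub>k\<close> the operator \<open>H\<close> is multiplication by \<open>k\<close>, so it is Hermitian term by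
  term, and the Hardy space becomes the space of square summable sequences. Everything else rests
  on the polynomials \<open>p\<close> with \<open>p(z\<^sub>i) = 0\<close> for all \<open>i\<close>, which lie in the domain of \<open>L\<^sub>n\<close>.

  \<^emph>\<open>Density.\<close> Evaluation at a point \<open>s\<close> of the unit circle is unbounded in the Hardy norm: multiplying a
  polynomial by the average \<open>(1/M) \<Sum>\<^sub>k\<^sub><\<^sub>M (w/s)\<^sup>k\<close> keeps its value at \<open>s\<close> and all its zeros, while the
  norm tends to 0 (\<open>small_poly_with_same_value\<close>). Subtracting such a product makes a polynomial vanish
  at one more point at arbitrarily small cost, and induction over the points gives density
  (\<open>vanishing_polys_dense\<close>).

  \<^emph>\<open>Deficiency indices.\<close> By density, \<open>g\<close> lies in the kernel of \<open>L\<^sub>n\<^sup>* - c\<close> iff the sequence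
  \<open>b\<^sub>k = cnj ((k - c) g\<^sub>k)\<close> pairs to zero with the coefficients of every \<open>f\<close> in the domain. The vanishing
  polynomials already determine \<open>b\<close>: \<open>w\<^sup>m\<close> minus its Lagrange interpolant at the \<open>z\<^sub>i\<close> vanishes at
  the \<open>z\<^sub>i\<close>, so \<open>b\<^sub>m\<close> is a combination \<open>\<Sum>\<^sub>i d\<^sub>i z\<^sub>i\<^sup>m\<close> with \<open>d\<^sub>i\<close> independent of \<open>m\<close>
  (\<open>coeffs_eq_power_sum_if_annihilates_vanishing\<close>). Hence, for \<open>c\<close> not a natural number, the kernel is
  spanned by the \<open>n\<close> functions with coefficients \<open>cnj z\<^sub>i\<^sup>k / (k - c)\<close>. They belong to it because
  for them the pairing with \<open>f\<close> is the boundary value of \<open>f\<close> at \<open>z\<^sub>i\<close>, and they are independent, again by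
  Lagrange interpolation. So the kernel has dimension \<open>n\<close>, in particular for \<open>c = \<plusminus>\<i>\<close>.
\<close>

section \<open>Taylor coefficients\<close>

lemma taylor_coeff_eqI:
  assumes "\<And>w. w \<in> ball 0 1 \<Longrightarrow> (\<lambda>k. a k * w ^ k) sums f w"
  shows "taylor_coeff f k = a k"
proof -
  have "eventually (\<lambda>w. w \<in> ball 0 1) (nhds (0::complex))"
    by (rule eventually_nhds_in_open) auto
  then have "eventually (\<lambda>w. (\<lambda>k. fps_nth (Abs_fps a) k * w ^ k) sums f w) (nhds 0)"
    by eventually_elim (use assms in simp)
  then have "f has_fps_expansion Abs_fps a"
    by (rule has_fps_expansionI)
  then show ?thesis
    using fps_nth_fps_expansion[of f "Abs_fps a" k] by (simp add: taylor_coeff_def)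
qed

lemma taylor_series_sums:
  assumes "f holomorphic_on ball 0 1" "w \<in> ball 0 1"
  shows "(\<lambda>k. taylor_coeff f k * w ^ k) sums f w"
  using holomorphic_power_series[OF assms] by (simp add: taylor_coeff_def)

lemma taylor_coeff_diff:
  assumes "f holomorphic_on ball 0 1" "g holomorphic_on ball 0 1"
  shows "taylor_coeff (f - g) k = taylor_coeff f k - taylor_coeff g k"
  by (rule taylor_coeff_eqI)
     (use sums_diff[OF taylor_series_sums[OF assms(1)] taylor_series_sums[OF assms(2)]]
      in \<open>simp add: algebra_simps\<close>)

lemma taylor_coeff_cscale:
  assumes "f holomorphic_on ball 0 1"
  shows "taylor_coeff (cscale c f) k = c * taylor_coeff f k"
  by (rule taylor_coeff_eqI)
     (use sums_mult[OF taylor_series_sums[OF assms], of _ c] in \<open>simp add: cscale_def algebra_simps\<close>)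

lemma sum_cscale_apply: "(\<Sum>i\<in>I. cscale (c i) (f i)) w = (\<Sum>i\<in>I. c i * f i w)"
  by (induction I rule: infinite_finite_induct) (auto simp: cscale_def)

lemma taylor_coeff_sum_cscale:
  assumes "\<And>i. i \<in> I \<Longrightarrow> f i holomorphic_on ball 0 1"
  shows "taylor_coeff (\<Sum>i\<in>I. cscale (c i) (f i)) k = (\<Sum>i\<in>I. c i * taylor_coeff (f i) k)"
proof (rule taylor_coeff_eqI)
  fix w :: complex assume w: "w \<in> ball 0 1"
  have "(\<lambda>k. \<Sum>i\<in>I. c i * (taylor_coeff (f i) k * w ^ k)) sums (\<Sum>i\<in>I. c i * f i w)"
    using assms w by (intro sums_sum sums_mult taylor_series_sums)
  then show "(\<lambda>k. (\<Sum>i\<in>I. c i * taylor_coeff (f i) k) * w ^ k) sums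
      (\<Sum>i\<in>I. cscale (c i) (f i)) w"
    by (simp add: sum_cscale_apply sum_distrib_right mult.assoc)
qed

lemma holomorphic_zddz:
  assumes "f holomorphic_on ball 0 1"
  shows "zddz f holomorphic_on ball 0 1"
proof -
  have "(\<lambda>w. w * deriv f w) holomorphic_on ball 0 1"
    using assms by (intro holomorphic_intros) auto
  then show ?thesis
    by (rule holomorphic_transform) (simp add: zddz_def)
qed

lemma taylor_coeff_zddz:
  assumes "f holomorphic_on ball 0 1"
  shows "taylor_coeff (zddz f) k = of_nat k * taylor_coeff f k"
proof -
  let ?F = "fps_expansion f 0"
  have F: "f has_fps_expansion ?F"
    using assms by (intro has_fps_expansion_fps_expansion[of "ball 0 1"]) auto
  have "(\<lambda>w. w * deriv f w) has_fps_expansion fps_X * fps_deriv ?F"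
    using F by (intro fps_expansion_intros)
  moreover have "eventually (\<lambda>w. w * deriv f w = zddz f w) (nhds 0)"
  proof -
    have "eventually (\<lambda>w. w \<in> ball 0 1) (nhds (0::complex))"
      by (rule eventually_nhds_in_open) auto
    then show ?thesis
      by eventually_elim (simp add: zddz_def)
  qed
  ultimately have "zddz f has_fps_expansion fps_X * fps_deriv ?F"
    by (subst (asm) has_fps_expansion_cong) auto
  then have "taylor_coeff (zddz f) k = fps_nth (fps_X * fps_deriv ?F) k"
    by (simp only: taylor_coeff_def fps_nth_fps_expansion)
  also have "\<dots> = of_nat k * fps_nth ?F k"
    by (cases k) auto
  also have "fps_nth ?F k = taylor_coeff f k"
    using fps_nth_fps_expansion[OF F] by (simp add: taylor_coeff_def)
  finally show ?thesis .
qed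

section \<open>Square summable sequences\<close>

definition square_summable :: "(nat \<Rightarrow> complex) \<Rightarrow> bool" where
  "square_summable a \<longleftrightarrow> summable (\<lambda>k. (cmod (a k))\<^sup>2)"

definition sqnorm :: "(nat \<Rightarrow> complex) \<Rightarrow> real" where
  "sqnorm a = (\<Sum>k. (cmod (a k))\<^sup>2)"

text \<open>A substitute for the triangle inequality of the norm, sufficient for all estimates below.\<close>

lemma norm_add_sq_le: "(norm (x + y))\<^sup>2 \<le> 2 * (norm x)\<^sup>2 + 2 * (norm (y :: complex))\<^sup>2"
proof -
  have "(norm (x + y))\<^sup>2 \<le> (norm x + norm y)\<^sup>2"
    by (intro power_mono norm_triangle_ineq) auto
  also have "\<dots> \<le> 2 * (norm x)\<^sup>2 + 2 * (norm y)\<^sup>2"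
    using sum_squares_bound[of "norm x" "norm y"] by (simp add: power2_sum)
  finally show ?thesis .
qed

lemma square_summable_mult_left: "square_summable a \<Longrightarrow> square_summable (\<lambda>k. c * a k)"
  unfolding square_summable_def by (simp add: norm_mult power_mult_distrib summable_mult)

lemma square_summable_add:
  assumes "square_summable a" "square_summable b"
  shows "square_summable (\<lambda>k. a k + b k)"
  unfolding square_summable_def
proof (rule summable_comparison_test')
  show "summable (\<lambda>k. 2 * (cmod (a k))\<^sup>2 + 2 * (cmod (b k))\<^sup>2)"
    using assms unfolding square_summable_def by (intro summable_add summable_mult)
qed (use norm_add_sq_le in auto)

lemma square_summable_diff:
  assumes "square_summable a" "square_summable b"
  shows "square_summable (\<lambda>k. a k - b k)"
  using square_summable_add[OF assms(1) square_summable_mult_left[OF assms(2), of "-1"]] by simp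

lemma square_summable_sum:
  assumes "\<And>i. i \<in> I \<Longrightarrow> square_summable (a i)"
  shows "square_summable (\<lambda>k. \<Sum>i\<in>I. a i k)"
  using assms
proof (induction I rule: infinite_finite_induct)
  case (insert i I)
  then have "square_summable (\<lambda>k. a i k + (\<Sum>i\<in>I. a i k))"
    by (intro square_summable_add) simp_all
  then show ?case using insert by simp
qed (auto simp: square_summable_def)

lemma sqnorm_add_le:
  assumes "square_summable a" "square_summable b"
  shows "sqnorm (\<lambda>k. a k + b k) \<le> 2 * sqnorm a + 2 * sqnorm b"
proof -
  have sum: "summable (\<lambda>k. 2 * (cmod (a k))\<^sup>2)" "summable (\<lambda>k. 2 * (cmod (b k))\<^sup>2)"
    using assms unfolding square_summable_def by (auto intro: summable_mult)
  have "sqnorm (\<lambda>k. a k + b k) \<le> (\<Sum>k. 2 * (cmod (a k))\<^sup>2 + 2 * (cmod (b k))\<^sup>2)"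
    unfolding sqnorm_def
    using square_summable_add[OF assms] summable_add[OF sum]
    by (intro suminf_le norm_add_sq_le) (auto simp: square_summable_def)
  also have "\<dots> = 2 * sqnorm a + 2 * sqnorm b"
    using assms unfolding sqnorm_def square_summable_def
    by (simp add: suminf_add[OF sum, symmetric] suminf_mult)
  finally show ?thesis .
qed

lemma summable_norm_mult_square_summable:
  assumes "square_summable a" "square_summable b"
  shows "summable (\<lambda>k. cmod (a k * b k))"
proof (rule summable_comparison_test')
  show "summable (\<lambda>k. (cmod (a k))\<^sup>2 + (cmod (b k))\<^sup>2)"
    using assms unfolding square_summable_def by (rule summable_add)
  fix k
  have "2 * (cmod (a k) * cmod (b k)) \<le> (cmod (a k))\<^sup>2 + (cmod (b k))\<^sup>2"
    using sum_squares_bound[of "cmod (a k)" "cmod (b k)"] by simp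
  moreover have "0 \<le> cmod (a k) * cmod (b k)" by simp
  ultimately show "norm (cmod (a k * b k)) \<le> (cmod (a k))\<^sup>2 + (cmod (b k))\<^sup>2"
    unfolding norm_mult real_norm_def abs_mult abs_norm_cancel by linarith
qed

lemma summable_cnj_mult:
  assumes "square_summable a" "square_summable b"
  shows "summable (\<lambda>k. cnj (a k) * b k)"
  using summable_norm_mult_square_summable[of "\<lambda>k. cnj (a k)" b] assms
  by (intro summable_norm_cancel[of "\<lambda>k. cnj (a k) * b k"]) (simp add: square_summable_def)

text \<open>This follows from the theorem of Pythagoras; it makes a vector orthogonal to a dense set vanish
  without any appeal to continuity of the inner product.\<close>

lemma sqnorm_le_sqnorm_diff_orthogonal:
  assumes a: "square_summable a" and b: "square_summable b"
    and orth: "(\<Sum>k. cnj (a k) * b k) = 0"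
  shows "sqnorm a \<le> sqnorm (\<lambda>k. a k - b k)"
proof -
  have s: "(\<lambda>k. cnj (a k) * b k) sums 0"
    using summable_sums[OF summable_cnj_mult[OF a b]] orth by simp
  have "(\<lambda>k. ((cmod (a k))\<^sup>2 + (cmod (b k))\<^sup>2) - 2 * Re (cnj (a k) * b k)) sums
      ((sqnorm a + sqnorm b) - 2 * Re 0)"
    unfolding sqnorm_def
    by (intro sums_diff sums_add sums_mult sums_Re s summable_sums a[unfolded square_summable_def]
        b[unfolded square_summable_def])
  moreover have "((cmod (a k))\<^sup>2 + (cmod (b k))\<^sup>2) - 2 * Re (cnj (a k) * b k) = (cmod (a k - b k))\<^sup>2" for k
    unfolding cmod_power2 by (simp add: power2_eq_square algebra_simps)
  ultimately have "sqnorm (\<lambda>k. a k - b k) = sqnorm a + sqnorm b"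
    unfolding sqnorm_def[of "\<lambda>k. a k - b k"] by (simp add: sums_iff)
  moreover have "sqnorm b \<ge> 0"
    unfolding sqnorm_def using b by (intro suminf_nonneg) (auto simp: square_summable_def)
  ultimately show ?thesis by simp
qed

lemma square_summable_finite_support:
  assumes "\<And>k. k > N \<Longrightarrow> a k = 0"
  shows "square_summable a"
  unfolding square_summable_def using assms by (intro summable_finite[of "{..N}"]) auto

section \<open>The Hardy space as a sequence space\<close>

text \<open>The inverse of \<^const>\<open>taylor_coeff\<close>, with the convention that members of \<^const>\<open>hardy2\<close> are
  zero outside the disc.\<close>

definition power_series_fun :: "(nat \<Rightarrow> complex) \<Rightarrow> complex \<Rightarrow> complex" where
  "power_series_fun a w = (if w \<in> ball 0 1 then \<Sum>k. a k * w ^ k else 0)"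

lemma power_series_fun_sums:
  assumes "square_summable a" "w \<in> ball 0 1"
  shows "(\<lambda>k. a k * w ^ k) sums power_series_fun a w"
proof -
  have "square_summable (\<lambda>k. w ^ k)"
  proof -
    have "(cmod w)\<^sup>2 < 1" using assms(2) by (simp add: power_less_one_iff abs_square_less_1)
    then have "summable (\<lambda>k. ((cmod w)\<^sup>2) ^ k)" by (intro summable_geometric) simp
    then show ?thesis
      unfolding square_summable_def by (simp add: norm_power power_mult[symmetric] mult.commute)
  qed
  from summable_norm_mult_square_summable[OF assms(1) this]
  show ?thesis
    using assms(2) by (simp add: power_series_fun_def summable_sums summable_norm_cancel)
qed

lemma taylor_coeff_power_series_fun:
  "square_summable a \<Longrightarrow> taylor_coeff (power_series_fun a) k = a k"
  by (rule taylor_coeff_eqI) (rule power_series_fun_sums)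

lemma power_series_fun_in_hardy2:
  assumes "square_summable a"
  shows "power_series_fun a \<in> hardy2"
proof -
  have "power_series_fun a holomorphic_on ball 0 1"
    using power_series_fun_sums[OF assms] by (intro power_series_holomorphic[where a = a]) simp
  then show ?thesis
    using assms by (simp add: hardy2_def taylor_coeff_power_series_fun square_summable_def)
      (simp add: power_series_fun_def)
qed

lemma hardy2_holomorphic: "f \<in> hardy2 \<Longrightarrow> f holomorphic_on ball 0 1"
  by (simp add: hardy2_def)

lemma hardy2_square_summable: "f \<in> hardy2 \<Longrightarrow> square_summable (taylor_coeff f)"
  by (simp add: hardy2_def square_summable_def)

lemma hardy2_eqI:
  assumes "f \<in> hardy2" "g \<in> hardy2" "\<And>k. taylor_coeff f k = taylor_coeff g k"
  shows "f = g"
proof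
  fix w
  show "f w = g w"
  proof (cases "w \<in> ball 0 1")
    case True
    then show ?thesis
      using taylor_series_sums[OF hardy2_holomorphic[OF assms(1)] True]
        taylor_series_sums[OF hardy2_holomorphic[OF assms(2)] True] assms(3)
      by (simp add: sums_iff)
  next
    case False
    then show ?thesis using assms by (simp add: hardy2_def)
  qed
qed

lemma hardy2_cscale: "f \<in> hardy2 \<Longrightarrow> cscale c f \<in> hardy2"
  using square_summable_mult_left[OF hardy2_square_summable, of f c]
  by (simp add: hardy2_def taylor_coeff_cscale square_summable_def)
     (auto simp: cscale_def intro!: holomorphic_intros)

lemma hardy2_diff: "f \<in> hardy2 \<Longrightarrow> g \<in> hardy2 \<Longrightarrow> f - g \<in> hardy2"
  using square_summable_diff[OF hardy2_square_summable hardy2_square_summable, of f g]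
  by (simp add: hardy2_def taylor_coeff_diff square_summable_def)
     (auto simp: fun_diff_def intro!: holomorphic_intros)

lemma hardy2_sum_cscale:
  assumes "\<And>i. i \<in> I \<Longrightarrow> f i \<in> hardy2"
  shows "(\<Sum>i\<in>I. cscale (c i) (f i)) \<in> hardy2"
proof -
  have "(\<lambda>w. \<Sum>i\<in>I. c i * f i w) holomorphic_on ball 0 1"
    using assms by (intro holomorphic_intros) (simp add: hardy2_def)
  then have "(\<Sum>i\<in>I. cscale (c i) (f i)) holomorphic_on ball 0 1"
    by (rule holomorphic_transform) (simp add: sum_cscale_apply)
  moreover have "square_summable (\<lambda>k. \<Sum>i\<in>I. c i * taylor_coeff (f i) k)"
    using assms by (intro square_summable_sum square_summable_mult_left hardy2_square_summable)
  ultimately show ?thesis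
    using assms
    by (simp add: hardy2_def taylor_coeff_sum_cscale square_summable_def sum_cscale_apply)
qed

lemma hardy_norm_eq: "hardy_norm f = sqrt (sqnorm (taylor_coeff f))"
  by (simp add: hardy_norm_def sqnorm_def)

lemma zddz_in_hardy2_iff:
  assumes "f \<in> hardy2"
  shows "zddz f \<in> hardy2 \<longleftrightarrow> square_summable (\<lambda>k. of_nat k * taylor_coeff f k)"
  using assms
  by (simp add: hardy2_def holomorphic_zddz taylor_coeff_zddz square_summable_def)
     (simp add: zddz_def)

section \<open>Polynomials with prescribed zeros\<close>

lemma square_summable_coeff: "square_summable (coeff p)"
  by (rule square_summable_finite_support[of "degree p"]) (rule coeff_eq_0)

lemma sums_mult_coeff:
  fixes b :: "nat \<Rightarrow> complex"
  shows "(\<lambda>k. b k * coeff p k) sums (\<Sum>k\<le>degree p. b k * coeff p k)"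
  by (intro sums_finite) (auto simp: coeff_eq_0)

lemma exists_lagrange_basis:
  fixes z :: "'i \<Rightarrow> 'a::field"
  assumes "finite I" "inj_on z I"
  shows "\<exists>\<phi>. \<forall>i\<in>I. \<forall>j\<in>I. poly (\<phi> i) (z j) = (if i = j then 1 else 0)"
proof (intro exI ballI)
  fix i j assume ij: "i \<in> I" "j \<in> I"
  let ?P = "\<lambda>i. \<Prod>l\<in>I - {i}. [:- z l, 1:]"
  show "poly (smult (inverse (poly (?P i) (z i))) (?P i)) (z j) = (if i = j then 1 else 0)"
  proof (cases "i = j")
    case True
    have "poly (?P i) (z i) \<noteq> 0"
      using assms ij by (auto simp: poly_prod inj_on_def)
    then show ?thesis using True by simp
  next
    case False
    then have "poly (?P i) (z j) = 0"
      using assms ij by (simp add: poly_prod) blast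
    then show ?thesis using False by simp
  qed
qed

text \<open>The functional \<open>p \<mapsto> \<Sum>\<^sub>k b\<^sub>k p\<^sub>k\<close> kills the difference between a polynomial and its Lagrange
  interpolant, hence it is a combination of the evaluations at the nodes \<open>z\<^sub>i\<close>. Its value at \<open>w\<^sup>m\<close>
  is \<open>b\<^sub>m\<close>.\<close>

lemma coeffs_eq_power_sum_if_annihilates_vanishing:
  fixes b :: "nat \<Rightarrow> complex"
  assumes I: "finite I" "inj_on z I"
    and ann: "\<And>p. (\<forall>i\<in>I. poly p (z i) = 0) \<Longrightarrow> (\<Sum>k. b k * coeff p k) = 0"
  shows "\<exists>c. \<forall>k. b k = (\<Sum>i\<in>I. c i * z i ^ k)"
proof -
  obtain \<phi> where \<phi>: "\<And>i j. i \<in> I \<Longrightarrow> j \<in> I \<Longrightarrow> poly (\<phi> i) (z j) = (if i = j then 1 else 0)"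
    using exists_lagrange_basis[OF I] by blast
  define B where "B p = (\<Sum>k\<le>degree p. b k * coeff p k)" for p
  have B: "(\<lambda>k. b k * coeff p k) sums B p" for p
    unfolding B_def by (rule sums_mult_coeff)
  have "b m = (\<Sum>i\<in>I. B (\<phi> i) * z i ^ m)" for m
  proof -
    let ?q = "monom 1 m - (\<Sum>i\<in>I. smult (z i ^ m) (\<phi> i))"
    have "poly ?q (z j) = 0" if "j \<in> I" for j
    proof -
      have "(\<Sum>i\<in>I. z i ^ m * poly (\<phi> i) (z j)) = (\<Sum>i\<in>I. if i = j then z i ^ m else 0)"
        using \<phi> that by (intro sum.cong) auto
      then show ?thesis
        using I that by (simp add: poly_monom poly_sum)
    qed
    then have "(\<Sum>k. b k * coeff ?q k) = 0"
      by (intro ann) blast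
    moreover have "(\<lambda>k. b k * coeff (monom 1 m) k - (\<Sum>i\<in>I. z i ^ m * (b k * coeff (\<phi> i) k))) sums
        (B (monom 1 m) - (\<Sum>i\<in>I. z i ^ m * B (\<phi> i)))"
      by (intro sums_diff sums_sum sums_mult B)
    then have "(\<lambda>k. b k * coeff ?q k) sums (B (monom 1 m) - (\<Sum>i\<in>I. z i ^ m * B (\<phi> i)))"
      by (simp add: coeff_sum algebra_simps sum_distrib_left)
    ultimately have "B (monom 1 m) = (\<Sum>i\<in>I. z i ^ m * B (\<phi> i))"
      by (simp add: sums_iff)
    moreover have "B (monom 1 m) = b m"
    proof (rule sums_unique2[OF B])
      show "(\<lambda>k. b k * coeff (monom 1 m) k) sums b m"
        using sums_single[of m b] by (rule back_subst[where P = "\<lambda>f. f sums b m"]) auto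
    qed
    ultimately show ?thesis by (simp add: mult.commute)
  qed
  then show ?thesis by (intro exI[of _ "\<lambda>i. B (\<phi> i)"] allI)
qed

text \<open>By linearity \<open>\<Sum>\<^sub>i c\<^sub>i p(z\<^sub>i) = 0\<close> for every polynomial \<open>p\<close>, in particular for the Lagrange
  polynomial of \<open>z\<^sub>j\<close>.\<close>

lemma power_sums_zero_imp_coeffs_zero:
  fixes z :: "'i \<Rightarrow> complex"
  assumes I: "finite I" "inj_on z I" and zero: "\<And>k. (\<Sum>i\<in>I. c i * z i ^ k) = 0" and j: "j \<in> I"
  shows "c j = 0"
proof -
  obtain \<phi> where \<phi>: "\<And>i j. i \<in> I \<Longrightarrow> j \<in> I \<Longrightarrow> poly (\<phi> i) (z j) = (if i = j then 1 else 0)"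
    using exists_lagrange_basis[OF I] by blast
  have "(\<Sum>i\<in>I. c i * poly p (z i)) = 0" for p
  proof -
    have "(\<Sum>i\<in>I. c i * poly p (z i)) = (\<Sum>k\<le>degree p. coeff p k * (\<Sum>i\<in>I. c i * z i ^ k))"
      unfolding poly_altdef sum_distrib_left by (subst sum.swap) (simp add: algebra_simps)
    then show ?thesis by (simp add: zero)
  qed
  moreover have "(\<Sum>i\<in>I. c i * poly (\<phi> j) (z i)) = (\<Sum>i\<in>I. if i = j then c i else 0)"
    using \<phi> j by (intro sum.cong) auto
  ultimately show ?thesis using I j by simp
qed

text \<open>The factor \<open>A = (1/M) \<Sum>\<^sub>k\<^sub><\<^sub>M (w/s)\<^sup>k\<close> has value 1 at \<open>s\<close> but all its coefficients have modulus at
  most \<open>1/M\<close>. The product \<open>pA\<close> has at most \<open>2M\<close> nonzero coefficients once \<open>M\<close> exceeds the degree of \<open>p\<close>,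
  each of order \<open>1/M\<close>, so its squared norm is of order \<open>1/M\<close>.\<close>

lemma small_poly_with_same_value:
  assumes s: "cmod s = 1" and e: "e > 0"
  shows "\<exists>q. p dvd q \<and> poly q s = poly p s \<and> sqnorm (coeff q) < e"
proof -
  define C where "C = (\<Sum>i\<le>degree p. cmod (coeff p i))"
  obtain M :: nat where M: "real M > max (real (degree p)) (2 * C\<^sup>2 / e)"
    using reals_Archimedean2 by blast
  then have M_pos: "M > 0" by (cases M) auto
  define A where "A = (\<Sum>k<M. monom (inverse s ^ k / of_nat M) k)"
  have "s \<noteq> 0" using s by auto
  then have A_s: "poly A s = 1"
    using M_pos unfolding A_def by (simp add: poly_sum poly_monom power_inverse)
  have coeff_A: "coeff A k = (if k < M then inverse s ^ k / of_nat M else 0)" for k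
    unfolding A_def coeff_sum by simp
  have norm_A: "cmod (coeff A k) \<le> 1 / M" for k
    using s by (simp add: coeff_A norm_divide norm_power norm_inverse)
  have bound: "cmod (coeff (p * A) k) \<le> C / M" for k
  proof -
    have "cmod (coeff (p * A) k) \<le> (\<Sum>i\<le>k. cmod (coeff p i) * (1 / M))"
      unfolding coeff_mult
    proof (rule sum_norm_le)
      fix i
      show "cmod (coeff p i * coeff A (k - i)) \<le> cmod (coeff p i) * (1 / M)"
        unfolding norm_mult by (intro mult_left_mono norm_A norm_ge_zero)
    qed
    also have "\<dots> = (\<Sum>i\<in>{..k} \<inter> {..degree p}. cmod (coeff p i) * (1 / M))"
      by (intro sum.mono_neutral_right) (auto intro: le_degree)
    also have "\<dots> \<le> (\<Sum>i\<le>degree p. cmod (coeff p i) * (1 / M))"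
      by (intro sum_mono2) auto
    also have "\<dots> = C / M"
      by (simp add: C_def sum_divide_distrib)
    finally show ?thesis .
  qed
  have "coeff (p * A) k = 0" if "k \<ge> 2 * M" for k
  proof -
    have "degree A \<le> M" by (intro degree_le) (simp add: coeff_A)
    then have "degree (p * A) < k"
      using that M degree_mult_le[of p A] by simp
    then show ?thesis by (rule coeff_eq_0)
  qed
  then have "sqnorm (coeff (p * A)) = (\<Sum>k<2 * M. (cmod (coeff (p * A) k))\<^sup>2)"
    unfolding sqnorm_def by (intro suminf_finite) auto
  also have "\<dots> \<le> (\<Sum>k<2 * M. (C / M)\<^sup>2)"
    by (intro sum_mono power_mono bound) auto
  also have "\<dots> = 2 * C\<^sup>2 / M"
    using M_pos by (simp add: power2_eq_square field_simps)
  also have "\<dots> < e"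
    using M M_pos e by (simp add: field_simps)
  finally show ?thesis
    using A_s by (intro exI[of _ "p * A"]) simp
qed

text \<open>To add a zero at \<open>s\<close>, subtract a small polynomial multiple of the polynomial found so far that agrees with it
  at \<open>s\<close>; being a multiple, it preserves the zeros already achieved.\<close>

lemma vanishing_polys_dense:
  assumes "finite S" "\<forall>s\<in>S. cmod s = 1" "e > 0"
  shows "\<exists>q. (\<forall>s\<in>S. poly q s = 0) \<and> sqnorm (coeff (p - q)) < e"
  using assms
proof (induction S arbitrary: e rule: finite_induct)
  case empty
  then show ?case by (intro exI[of _ p]) (simp add: sqnorm_def)
next
  case (insert s S)
  have "\<exists>q. (\<forall>s\<in>S. poly q s = 0) \<and> sqnorm (coeff (p - q)) < e / 4"
    using insert.prems by (intro insert.IH) auto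
  then obtain q where q: "\<forall>s\<in>S. poly q s = 0" "sqnorm (coeff (p - q)) < e / 4"
    by blast
  obtain r where r: "q dvd r" "poly r s = poly q s" "sqnorm (coeff r) < e / 4"
    using small_poly_with_same_value[of s "e / 4" q] insert.prems by auto
  have "coeff (p - (q - r)) = (\<lambda>k. coeff (p - q) k + coeff r k)"
    by (rule ext) simp
  then have "sqnorm (coeff (p - (q - r))) = sqnorm (\<lambda>k. coeff (p - q) k + coeff r k)"
    by (rule arg_cong)
  also have "\<dots> \<le> 2 * sqnorm (coeff (p - q)) + 2 * sqnorm (coeff r)"
    by (intro sqnorm_add_le square_summable_coeff)
  also have "\<dots> < e" using q r by simp
  finally have "sqnorm (coeff (p - (q - r))) < e" .
  moreover have "poly (q - r) t = 0" if "t \<in> insert s S" for t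
  proof (cases "t = s")
    case False
    then have "poly q t = 0" using that q(1) by blast
    moreover obtain q' where "r = q * q'" using r(1) by (rule dvdE)
    ultimately show ?thesis by simp
  qed (simp add: r(2))
  ultimately show ?case by blast
qed


section \<open>The restricted operator\<close>

lemma op_dom_L_op: "op_dom (L_op n z) =
    {f \<in> hardy2. zddz f \<in> hardy2 \<and> (\<forall>i\<in>{1..n}. disc_ext f (z i) = 0)}"
  by (auto simp: L_op_def op_restrict_def H_op_def D_pts_def)

lemma op_app_L_op: "op_app (L_op n z) = zddz"
  by (simp add: L_op_def op_restrict_def H_op_def)

lemma poly_in_L_op_dom:
  assumes "\<forall>i\<in>{1..n}. poly p (z i) = 0"
  shows "power_series_fun (coeff p) \<in> op_dom (L_op n z)"
proof -
  have "square_summable (\<lambda>k. of_nat k * coeff p k)"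
    by (rule square_summable_finite_support[of "degree p"]) (simp add: coeff_eq_0)
  moreover have "disc_ext (power_series_fun (coeff p)) w = poly p w" for w
    using sums_mult_coeff[of "\<lambda>k. w ^ k" p]
    by (simp add: disc_ext_def taylor_coeff_power_series_fun square_summable_coeff poly_altdef
        sums_iff mult.commute)
  ultimately show ?thesis
    using assms
    by (simp add: op_dom_L_op power_series_fun_in_hardy2 square_summable_coeff
        zddz_in_hardy2_iff taylor_coeff_power_series_fun)
qed

lemma hermitian_L_op: "hermitian (L_op n z)"
  unfolding hermitian_def op_app_L_op
proof (intro ballI)
  fix f g assume "f \<in> op_dom (L_op n z)" "g \<in> op_dom (L_op n z)"
  then have "f holomorphic_on ball 0 1" "g holomorphic_on ball 0 1"
    by (auto simp: op_dom_L_op hardy2_holomorphic)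
  then show "hardy_inner f (zddz g) = hardy_inner (zddz f) g"
    by (simp add: hardy_inner_def taylor_coeff_zddz mult.commute mult.left_commute)
qed

text \<open>A Taylor polynomial \<open>p\<close> of \<open>f\<close> is close to \<open>f\<close>, and a vanishing polynomial is close to \<open>p\<close>.\<close>

lemma densely_defined_L_op:
  assumes "\<forall>i\<in>{1..n}. cmod (z i) = 1"
  shows "densely_defined (L_op n z)"
  unfolding densely_defined_def
proof (intro conjI ballI allI impI)
  show "op_dom (L_op n z) \<subseteq> hardy2" by (auto simp: op_dom_L_op)
  fix f and e :: real assume f: "f \<in> hardy2" and e: "e > 0"
  let ?a = "taylor_coeff f"
  have sum_a: "summable (\<lambda>k. (cmod (?a k))\<^sup>2)"
    using hardy2_square_summable[OF f] by (simp add: square_summable_def)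
  obtain N where N: "norm (\<Sum>k. (cmod (?a (k + N)))\<^sup>2) < e\<^sup>2 / 4"
    using suminf_exist_split[OF _ sum_a, of "e\<^sup>2 / 4"] e by auto
  define p where "p = (\<Sum>k<N. monom (?a k) k)"
  have coeff_p: "coeff p k = (if k < N then ?a k else 0)" for k
    unfolding p_def coeff_sum by simp
  have ap: "square_summable (\<lambda>k. ?a k - coeff p k)"
    by (intro square_summable_diff hardy2_square_summable f square_summable_coeff)
  have "sqnorm (\<lambda>k. ?a k - coeff p k) = (\<Sum>k. (cmod (?a (k + N)))\<^sup>2)"
    using suminf_split_initial_segment[OF ap[unfolded square_summable_def], of N]
    by (simp add: sqnorm_def coeff_p)
  then have tail: "sqnorm (\<lambda>k. ?a k - coeff p k) < e\<^sup>2 / 4"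
    using N by simp
  have "\<exists>q. (\<forall>s\<in>z ` {1..n}. poly q s = 0) \<and> sqnorm (coeff (p - q)) < e\<^sup>2 / 4"
    using assms e by (intro vanishing_polys_dense) auto
  then obtain q where q: "\<forall>s\<in>z ` {1..n}. poly q s = 0" "sqnorm (coeff (p - q)) < e\<^sup>2 / 4"
    by blast
  let ?g = "power_series_fun (coeff q)"
  have g: "?g \<in> op_dom (L_op n z)"
    using q(1) by (intro poly_in_L_op_dom) blast
  have "taylor_coeff (f - ?g) = (\<lambda>k. (?a k - coeff p k) + coeff (p - q) k)"
    by (rule ext) (simp add: taylor_coeff_diff hardy2_holomorphic f power_series_fun_in_hardy2
        square_summable_coeff taylor_coeff_power_series_fun)
  then have "sqnorm (taylor_coeff (f - ?g)) \<le>
      2 * sqnorm (\<lambda>k. ?a k - coeff p k) + 2 * sqnorm (coeff (p - q))"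
    using sqnorm_add_le[OF ap square_summable_coeff[of "p - q"]] by simp
  also have "\<dots> < e\<^sup>2" using tail q(2) by simp
  finally have "hardy_norm (f - ?g) < e"
    unfolding hardy_norm_eq using e by (simp add: real_less_lsqrt)
  with g show "\<exists>g\<in>op_dom (L_op n z). hardy_norm (f - g) < e" by blast
qed

section \<open>Eigenspaces of the adjoint\<close>

lemma hardy_inner_dense_unique:
  assumes L: "densely_defined L" and h: "h \<in> hardy2" "h' \<in> hardy2"
    and eq: "\<forall>f\<in>op_dom L. hardy_inner h f = hardy_inner h' f"
  shows "h = h'"
proof -
  define d where "d = h - h'"
  have d: "d \<in> hardy2" unfolding d_def using h by (rule hardy2_diff)
  note sq = hardy2_square_summable
  have sqnorm_lt: "sqnorm (taylor_coeff d) < e\<^sup>2" if e: "e > 0" for e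
  proof -
    obtain g where g: "g \<in> op_dom L" "hardy_norm (d - g) < e"
      using L d e unfolding densely_defined_def by blast
    then have g2: "g \<in> hardy2" using L by (auto simp: densely_defined_def)
    have "(\<Sum>k. cnj (taylor_coeff h k) * taylor_coeff g k - cnj (taylor_coeff h' k) * taylor_coeff g k)
        = hardy_inner h g - hardy_inner h' g"
      unfolding hardy_inner_def
      by (intro suminf_diff[symmetric] summable_cnj_mult sq h g2)
    then have orth: "(\<Sum>k. cnj (taylor_coeff d k) * taylor_coeff g k) = 0"
      using eq g(1) h by (simp add: d_def taylor_coeff_diff hardy2_holomorphic algebra_simps)
    have "sqnorm (taylor_coeff d) \<le> sqnorm (\<lambda>k. taylor_coeff d k - taylor_coeff g k)"
      by (rule sqnorm_le_sqnorm_diff_orthogonal[OF sq[OF d] sq[OF g2] orth])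
    also have "\<dots> = sqnorm (taylor_coeff (d - g))"
      using d g2 by (simp add: sqnorm_def taylor_coeff_diff hardy2_holomorphic)
    also have "\<dots> < e\<^sup>2"
    proof -
      have "sqrt (sqnorm (taylor_coeff (d - g))) < sqrt (e\<^sup>2)"
        using g(2) e by (simp add: hardy_norm_eq)
      then show ?thesis by (simp only: real_sqrt_less_iff)
    qed
    finally show ?thesis .
  qed
  have sum_d: "summable (\<lambda>k. (cmod (taylor_coeff d k))\<^sup>2)"
    using sq[OF d] by (simp add: square_summable_def)
  have "sqnorm (taylor_coeff d) \<le> 0"
  proof (rule ccontr)
    assume "\<not> sqnorm (taylor_coeff d) \<le> 0"
    \<comment> \<open>Otherwise \<open>e = \<parallel>d\<parallel>\<close> is an admissible distance.\<close>
    then show False using sqnorm_lt[of "sqrt (sqnorm (taylor_coeff d))"] by simp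
  qed
  then have "taylor_coeff d k = 0" for k
    using suminf_eq_zero_iff[OF sum_d] suminf_nonneg[OF sum_d] by (simp add: sqnorm_def)
  then show ?thesis
    using h by (intro hardy2_eqI) (simp_all add: d_def taylor_coeff_diff hardy2_holomorphic)
qed

text \<open>Density makes the value of the adjoint unique, so the description operator in
  \<^const>\<open>adjoint_op\<close> can be eliminated.\<close>

lemma eigen_ker_adjoint_op:
  assumes "densely_defined L"
  shows "eigen_ker (adjoint_op L) c =
    {g \<in> hardy2. \<forall>f\<in>op_dom L. hardy_inner g (op_app L f) = hardy_inner (cscale c g) f}"
    (is "_ = ?E")
proof -
  let ?P = "\<lambda>g h. h \<in> hardy2 \<and> (\<forall>f\<in>op_dom L. hardy_inner g (op_app L f) = hardy_inner h f)"
  have the: "(THE h. ?P g h) = h" if "?P g h" for g h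
    using that hardy_inner_dense_unique[OF assms, of _ h] by (intro the_equality) auto
  show ?thesis
  proof (intro set_eqI iffI)
    fix g assume "g \<in> eigen_ker (adjoint_op L) c"
    then have "g \<in> hardy2" "\<exists>h. ?P g h" and eq: "(THE h. ?P g h) - cscale c g = 0"
      unfolding eigen_ker_def adjoint_op_def by auto
    then obtain h where h: "g \<in> hardy2" "?P g h" by blast
    have "h = cscale c g" using eq the[OF h(2)] by simp
    then show "g \<in> ?E" using h by simp
  next
    fix g assume "g \<in> ?E"
    then have g: "g \<in> hardy2" "?P g (cscale c g)" by (auto intro: hardy2_cscale)
    then show "g \<in> eigen_ker (adjoint_op L) c"
      unfolding eigen_ker_def adjoint_op_def using the[OF g(2)] by auto
  qed
qed

lemma hardy_inner_zddz_minus_eigenvalue: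
  assumes g: "g \<in> hardy2" and f: "f \<in> hardy2" "zddz f \<in> hardy2"
  shows "hardy_inner g (zddz f) - hardy_inner (cscale c g) f =
    (\<Sum>k. cnj ((of_nat k - c) * taylor_coeff g k) * taylor_coeff f k)"
proof -
  have "hardy_inner g (zddz f) - hardy_inner (cscale c g) f =
    (\<Sum>k. cnj (taylor_coeff g k) * taylor_coeff (zddz f) k -
      cnj (taylor_coeff (cscale c g) k) * taylor_coeff f k)"
    unfolding hardy_inner_def
    by (intro suminf_diff summable_cnj_mult hardy2_square_summable g f hardy2_cscale)
  then show ?thesis
    using g f by (simp add: taylor_coeff_zddz taylor_coeff_cscale hardy2_holomorphic algebra_simps)
qed

text \<open>The terms are at most \<open>2/k\<close> in modulus as soon as \<open>k \<ge> 2 \<bar>c\<bar>\<close>.\<close>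

lemma square_summable_resolvent_coeffs:
  assumes "cmod w = 1"
  shows "square_summable (\<lambda>k. w ^ k / (of_nat k - c))"
  unfolding square_summable_def
proof (rule summable_comparison_test_ev)
  show "summable (\<lambda>k. 4 * inverse (real k ^ 2))"
    by (intro summable_mult inverse_power_summable) simp
  obtain N :: nat where N: "real N > 2 * cmod c"
    using reals_Archimedean2 by blast
  show "eventually (\<lambda>k. norm ((cmod (w ^ k / (of_nat k - c)))\<^sup>2) \<le> 4 * inverse (real k ^ 2)) sequentially"
    using eventually_ge_at_top[of "max N 1"]
  proof eventually_elim
    fix k assume k: "max N 1 \<le> k"
    have "cmod (of_nat k - c) \<ge> real k - cmod c"
      using norm_triangle_ineq2[of "of_nat k" c] by simp
    also have "real k - cmod c \<ge> real k / 2" using N k by simp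
    finally have "1 / cmod (of_nat k - c) \<le> 1 / (real k / 2)"
      using k by (intro frac_le) auto
    then have "cmod (w ^ k / (of_nat k - c)) \<le> 1 / (real k / 2)"
      using assms by (simp add: norm_divide norm_power)
    then have "(cmod (w ^ k / (of_nat k - c)))\<^sup>2 \<le> (1 / (real k / 2))\<^sup>2"
      by (intro power_mono) auto
    also have "(1 / (real k / 2))\<^sup>2 = 4 * inverse (real k ^ 2)"
      by (simp add: power_divide inverse_eq_divide)
    finally show "norm ((cmod (w ^ k / (of_nat k - c)))\<^sup>2) \<le> 4 * inverse (real k ^ 2)"
      by (simp only: real_norm_def abs_power2)
  qed
qed

text \<open>A basis consists of the functions \<open>u i\<close> with coefficients \<open>cnj z\<^sub>i\<^sup>k / (k - c)\<close>. Dividing by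
  \<open>k - c\<close> turns the power sums provided by the vanishing polynomials into members of the Hardy space,
  and this is where \<open>c \<notin> \<nat>\<close> enters: if \<open>c\<close> is a natural number, the coefficient with index \<open>k = c\<close>
  is not determined by \<open>(k - c) g\<^sub>k\<close>.\<close>

lemma cdim_eigen_ker_adjoint_L_op:
  assumes inj: "inj_on z {1..n}" and unit: "\<forall>i\<in>{1..n}. cmod (z i) = 1" and c: "c \<notin> \<nat>"
  shows "cdim (eigen_ker (adjoint_op (L_op n z)) c) = enat n"
proof -
  let ?I = "{1..n}"
  let ?E = "eigen_ker (adjoint_op (L_op n z)) c"
  define u where "u i = power_series_fun (\<lambda>k. cnj (z i) ^ k / (of_nat k - c))" for i
  have kc: "of_nat k - c \<noteq> 0" for k using c by auto
  have sq_u: "square_summable (\<lambda>k. cnj (z i) ^ k / (of_nat k - c))" if "i \<in> ?I" for i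
    using unit that by (intro square_summable_resolvent_coeffs) simp
  have u: "u i \<in> hardy2" if "i \<in> ?I" for i
    unfolding u_def using sq_u[OF that] by (rule power_series_fun_in_hardy2)
  have coeff_u: "taylor_coeff (u i) k = cnj (z i) ^ k / (of_nat k - c)" if "i \<in> ?I" for i k
    unfolding u_def using sq_u[OF that] by (rule taylor_coeff_power_series_fun)
  have coeff_sum_u: "(of_nat k - c) * taylor_coeff (\<Sum>i\<in>?I. cscale (d i) (u i)) k =
      (\<Sum>i\<in>?I. d i * cnj (z i) ^ k)" for d k
  proof -
    have "taylor_coeff (\<Sum>i\<in>?I. cscale (d i) (u i)) k = (\<Sum>i\<in>?I. d i * taylor_coeff (u i) k)"
      by (intro taylor_coeff_sum_cscale hardy2_holomorphic u)
    also have "(of_nat k - c) * \<dots> = (\<Sum>i\<in>?I. d i * cnj (z i) ^ k)"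
      unfolding sum_distrib_left using kc[of k] by (intro sum.cong) (auto simp: coeff_u)
    finally show ?thesis .
  qed
  have E: "g \<in> ?E \<longleftrightarrow> g \<in> hardy2 \<and> (\<forall>f\<in>op_dom (L_op n z).
      (\<Sum>k. cnj ((of_nat k - c) * taylor_coeff g k) * taylor_coeff f k) = 0)" for g
  proof -
    have "hardy_inner g (zddz f) = hardy_inner (cscale c g) f \<longleftrightarrow>
        (\<Sum>k. cnj ((of_nat k - c) * taylor_coeff g k) * taylor_coeff f k) = 0"
      if "g \<in> hardy2" "f \<in> op_dom (L_op n z)" for f
      using hardy_inner_zddz_minus_eigenvalue[of g f c] that
      by (subst eq_iff_diff_eq_0) (simp add: op_dom_L_op)
    then show ?thesis
      unfolding eigen_ker_adjoint_op[OF densely_defined_L_op[OF unit]] op_app_L_op by blast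
  qed
  have inj_u: "inj_on u ?I"
  proof (rule inj_onI)
    fix i j assume ij: "i \<in> ?I" "j \<in> ?I" "u i = u j"
    \<comment> \<open>The coefficient with index 1 recovers \<open>z i\<close>.\<close>
    then have "taylor_coeff (u i) 1 = taylor_coeff (u j) 1" by simp
    then have "cnj (z i) ^ 1 / (of_nat 1 - c) = cnj (z j) ^ 1 / (of_nat 1 - c)"
      unfolding coeff_u[OF ij(1)] coeff_u[OF ij(2)] .
    then have "z i = z j" using kc[of 1] by simp
    then show "i = j" by (rule inj_onD[OF inj]) (fact ij)+
  qed
  have inj_cnj: "inj_on (\<lambda>i. cnj (z i)) ?I"
    by (rule inj_onI, rule inj_onD[OF inj]) simp_all
  \<comment> \<open>Against \<open>u i\<close> the factor \<open>k - c\<close> cancels and the pairing is evaluation at \<open>z i\<close>.\<close>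
  have "u ` ?I \<subseteq> ?E"
  proof
    fix g assume "g \<in> u ` ?I"
    then obtain i where i: "i \<in> ?I" "g = u i" by blast
    have "cnj ((of_nat k - c) * taylor_coeff g k) * taylor_coeff f k = taylor_coeff f k * z i ^ k" for f k
      using kc[of k] i by (simp add: coeff_u)
    then have "(\<Sum>k. cnj ((of_nat k - c) * taylor_coeff g k) * taylor_coeff f k) = disc_ext f (z i)" for f
      by (simp only: disc_ext_def)
    moreover have "disc_ext f (z i) = 0" if "f \<in> op_dom (L_op n z)" for f
      using that i(1) by (simp add: op_dom_L_op)
    ultimately show "g \<in> ?E" unfolding E using u[OF i(1)] i(2) by (simp only:) blast
  qed
  moreover have "?E \<subseteq> cfun.span (u ` ?I)"
  proof
    fix g assume "g \<in> ?E"
    then have g: "g \<in> hardy2" and ann: "\<And>f. f \<in> op_dom (L_op n z) \<Longrightarrow>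
        (\<Sum>k. cnj ((of_nat k - c) * taylor_coeff g k) * taylor_coeff f k) = 0"
      unfolding E by auto
    let ?b = "\<lambda>k. cnj ((of_nat k - c) * taylor_coeff g k)"
    have "(\<Sum>k. ?b k * coeff p k) = 0" if "\<forall>i\<in>?I. poly p (z i) = 0" for p
      using ann[OF poly_in_L_op_dom[OF that]]
      by (simp only: taylor_coeff_power_series_fun[OF square_summable_coeff])
    from coeffs_eq_power_sum_if_annihilates_vanishing[OF _ inj this]
    obtain d where d: "\<And>k. ?b k = (\<Sum>i\<in>?I. d i * z i ^ k)" by auto
    have "g = (\<Sum>i\<in>?I. cscale (cnj (d i)) (u i))"
    proof (rule hardy2_eqI)
      fix k
      have "(of_nat k - c) * taylor_coeff g k = cnj (?b k)" by simp
      also have "\<dots> = (of_nat k - c) * taylor_coeff (\<Sum>i\<in>?I. cscale (cnj (d i)) (u i)) k"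
        unfolding d coeff_sum_u by simp
      finally show "taylor_coeff g k = taylor_coeff (\<Sum>i\<in>?I. cscale (cnj (d i)) (u i)) k"
        using kc[of k] by simp
    qed (use g u in \<open>auto intro: hardy2_sum_cscale\<close>)
    then show "g \<in> cfun.span (u ` ?I)"
      by (simp only:) (intro cfun.span_sum cfun.span_scale cfun.span_base imageI)
  qed
  moreover have "cfun.independent (u ` ?I)"
  proof (rule cfun.independent_if_scalars_zero)
    fix d x assume sum: "(\<Sum>x\<in>u ` ?I. cscale (d x) x) = 0" and x: "x \<in> u ` ?I"
    have "taylor_coeff 0 k = 0" for k
      using taylor_coeff_eqI[of "\<lambda>_. 0" 0 k] by simp
    moreover have "(\<Sum>i\<in>?I. cscale (d (u i)) (u i)) = 0"
      using sum by (simp only: sum.reindex[OF inj_u] o_def)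
    ultimately have zero: "(\<Sum>i\<in>?I. d (u i) * cnj (z i) ^ k) = 0" for k
      using coeff_sum_u[of k "\<lambda>i. d (u i)"] by (simp only: mult_zero_right)
    obtain i where i: "i \<in> ?I" "x = u i" using x by (rule imageE)
    have "d (u i) = 0"
      by (rule power_sums_zero_imp_coeffs_zero[where c = "\<lambda>i. d (u i)",
            OF finite_atLeastAtMost inj_cnj zero i(1)])
    then show "d x = 0" by (simp only: i(2))
  qed simp
  moreover have "card (u ` ?I) = n"
    unfolding card_image[OF inj_u] by simp
  ultimately have "cfun.dim ?E = n"
    by (rule cfun.dim_unique)
  moreover have "\<exists>B. finite B \<and> ?E \<subseteq> cfun.span B"
    using \<open>?E \<subseteq> cfun.span (u ` ?I)\<close> by (intro exI[of _ "u ` ?I"]) simp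
  ultimately show ?thesis by (simp add: cdim_def)
qed

lemma notin_Nats_if_Im_nonzero: "Im c \<noteq> 0 \<Longrightarrow> c \<notin> \<nat>"
  by (metis Nats_cases complex_Im_of_nat)

theorem corollary6p13:
  fixes n :: nat and z :: "nat \<Rightarrow> complex"
  assumes "n \<ge> 1"
    and "inj_on z {1..n}"
    and "\<forall>i\<in>{1..n}. cmod (z i) = 1"
  shows "hermitian (L_op n z) \<and> densely_defined (L_op n z) \<and>
    deficiency_indices (L_op n z) = (enat n, enat n)"
proof -
  have "cdim (eigen_ker (adjoint_op (L_op n z)) c) = enat n" if "Im c \<noteq> 0" for c
    using assms(2,3) notin_Nats_if_Im_nonzero[OF that] by (rule cdim_eigen_ker_adjoint_L_op)
  then have "cdim (eigen_ker (adjoint_op (L_op n z)) \<i>) = enat n"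
    and "cdim (eigen_ker (adjoint_op (L_op n z)) (- \<i>)) = enat n"
    by simp_all
  then have "deficiency_indices (L_op n z) = (enat n, enat n)"
    by (simp only: deficiency_indices_def)
  then show ?thesis
    using hermitian_L_op densely_defined_L_op[OF assms(3)] by blast
qed

end
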